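(* Let $g:\mathbb{R}\to\mathbb{R}$ be any differentiable, monotone increasing and strictly convex function, and let $\mathrm{ALG}_g$ denote the Weighted-Balanced-Utilization algorithm (described in the context) run with $g$. Then $$\Gamma_{\mathrm{weighted\text{-}matching}}(\mathrm{ALG}_g,\mathrm{OPT}_{\mathrm{online}})\;\ge\;\Gamma_{\mathrm{weighted\text{-}matching}}(\mathrm{ALG}_g,\mathrm{OPT}_{\mathrm{offline}})\;\ge\;\tfrac34 .$$
   Context: Vertex-weighted two-stage stochastic matching. An instance consists of a finite bipartite graph $G=(D,S,E)$ whose demand side is partitioned as $D=D_1\cup D_2$, weights $w_j>0$ for supply vertices $j\in S$, and probabilities $\pi_i\in[0,1]$ for $i\in D_2$. Matching process: in the first stage an algorithm chooses a (possibly random) matching $M_1$ of the induced subgraph $G[D_1,S]$. In the second stage each $i\in D_2$ is available independently with probability $\pi_i$; let $\tilde D_2$ be the random set of available vertices. The algorithm then chooses a matching $M_2$ between $\tilde D_2$ and the supply vertices left unmatched by $M_1$. The value of the algorithm is $\mathbb{E}\big[\sum_{j\in S}w_j\mathbf{1}\{j\text{ is matched in }M_1\cup M_2\}\big]$ (expectation over the algorithm's randomness and $\tilde D_2$). For $X\subseteq D$, $Y\subseteq S$, let $\mathrm{MWM}(X,Y)$ be the maximum over matchings of $G[X,Y]$ of the total weight of matched supply vertices. Benchmarks: $\mathrm{OPT}_{\mathrm{offline}}=\mathbb{E}_{\tilde D_2}[\mathrm{MWM}(D_1\cup\tilde D_2,S)]$, and $\mathrm{OPT}_{\mathrm{online}}=\max_{M_1}\big(\sum_{j\in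 S_1}w_j+\mathbb{E}_{\tilde D_2}[\mathrm{MWM}(\tilde D_2,S\setminus S_1)]\big)$, the maximum over matchings $M_1$ of $G[D_1,S]$, with $S_1$ the supply vertices matched by $M_1$. The competitive ratio $\Gamma_{\mathrm{weighted\text{-}matching}}(\mathrm{ALG},\mathrm{OPT})$ is the minimum over all instances $(G,\{w_j\},\{\pi_i\})$ of (value of ALG)/OPT. Weighted-Balanced-Utilization with function $g$: for $i\in D_1$ let $N(i)$ be its neighbours in $S$ and for $j\in S$ let $N(j)$ be its neighbours in $D_1$ (in $G[D_1,S]$). Compute an optimal solution $x^*$ of the convex program $$\min\ \sum_{j\in S}\frac{1}{w_j}\,g\Big(w_j\big(1-\textstyle\sum_{i\in N(j)}x_{ij}\big)\Big)\ \text{s.t.}\ \sum_{j\in N(i)}x_{ij}\le1\ (i\in D_1),\ \sum_{i\in N(j)}x_{ij}\le 1\ (j\in S),\ x_{ij}\ge0\ ((i,j)\in E,\ i\in D_1).$$ Sample a matching $M_1$ of $G[D_1,S]$ with $\Pr[(i,j)\in M_1]=x^*_{ij}$ for every edge (possible since $x^*$ lies in the bipartite matching polytope). In the second stage output a maximum supply-weighted matching $M_2$ between $\tilde D_2$ and the supply vertices unmatched by $M_1$. *)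

theory Defs
  imports "HOL-Probability.Probability"
begin

definition strictly_convex :: "(real \<Rightarrow> real) \<Rightarrow> bool" where
  "strictly_convex g \<longleftrightarrow>
     (\<forall>x y t. x \<noteq> y \<longrightarrow> 0 < t \<longrightarrow> t < 1 \<longrightarrow>
        g ((1 - t) * x + t * y) < (1 - t) * g x + t * g y)"

record ('d, 's) two_stage =
  demand1 :: "'d set"
  demand2 :: "'d set"
  supplies :: "'s set"
  edges :: "('d \<times> 's) set"
  weight :: "'s \<Rightarrow> real"
  avail_prob :: "'d \<Rightarrow> real"

definition valid_two_stage :: "('d, 's) two_stage \<Rightarrow> bool" where
  "valid_two_stage I \<longleftrightarrow>
     finite (demand1 I) \<and> finite (demand2 I) \<and> demand1 I \<inter> demand2 I = {} \<and>
     finite (supplies I) \<and> edges I \<subseteq> (demand1 I \<union> demand2 I) \<times> supplies I \<and>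
     (\<forall>j\<in>supplies I. weight I j > 0) \<and>
     (\<forall>i\<in>demand2 I. 0 \<le> avail_prob I i \<and> avail_prob I i \<le> 1)"

definition matchings :: "('d, 's) two_stage \<Rightarrow> 'd set \<Rightarrow> 's set \<Rightarrow> ('d \<times> 's) set set" where
  "matchings I X Y =
     {M. M \<subseteq> edges I \<inter> X \<times> Y \<and>
         (\<forall>e\<in>M. \<forall>f\<in>M. fst e = fst f \<or> snd e = snd f \<longrightarrow> e = f)}"

definition supply_weight :: "('d, 's) two_stage \<Rightarrow> ('d \<times> 's) set \<Rightarrow> real" where
  "supply_weight I M = (\<Sum>j\<in>snd ` M. weight I j)"

definition mwm :: "('d, 's) two_stage \<Rightarrow> 'd set \<Rightarrow> 's set \<Rightarrow> real" where
  "mwm I X Y = Max (supply_weight I ` matchings I X Y)"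

definition available_pmf :: "('d, 's) two_stage \<Rightarrow> 'd set pmf" where
  "available_pmf I =
     map_pmf (\<lambda>a. {i \<in> demand2 I. a i})
       (Pi_pmf (demand2 I) False (\<lambda>i. bernoulli_pmf (avail_prob I i)))"

definition opt_offline :: "('d, 's) two_stage \<Rightarrow> real" where
  "opt_offline I =
     measure_pmf.expectation (available_pmf I) (\<lambda>A. mwm I (demand1 I \<union> A) (supplies I))"

definition opt_online :: "('d, 's) two_stage \<Rightarrow> real" where
  "opt_online I =
     Max ((\<lambda>M1. supply_weight I M1 +
             measure_pmf.expectation (available_pmf I) (\<lambda>A. mwm I A (supplies I - snd ` M1)))
          ` matchings I (demand1 I) (supplies I))"

text \<open>The second stage sees the first-stage matching and the set of available vertices. It may
  itself be random, for instance in how it breaks ties.\<close>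

record ('d, 's) two_stage_alg =
  first_stage :: "('d, 's) two_stage \<Rightarrow> ('d \<times> 's) set pmf"
  second_stage :: "('d, 's) two_stage \<Rightarrow> ('d \<times> 's) set \<Rightarrow> 'd set \<Rightarrow> ('d \<times> 's) set pmf"

definition alg_outcome ::
  "('d, 's) two_stage_alg \<Rightarrow> ('d, 's) two_stage \<Rightarrow> ('d \<times> 's) set pmf" where
  "alg_outcome ALG I =
     bind_pmf (first_stage ALG I) (\<lambda>M1.
     bind_pmf (available_pmf I) (\<lambda>A.
     map_pmf (\<lambda>M2. M1 \<union> M2) (second_stage ALG I M1 A)))"

definition alg_value :: "('d, 's) two_stage_alg \<Rightarrow> ('d, 's) two_stage \<Rightarrow> real" where
  "alg_value ALG I =
     measure_pmf.expectation (alg_outcome ALG I)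
       (\<lambda>M. \<Sum>j\<in>supplies I. weight I j * indicator (snd ` M) j)"

text \<open>Instances with optimum 0, where the ratio would be 0/0, are left out. The infimum is over
  a nonempty set of nonnegative reals: a single edge with a supply vertex of weight 1 has
  optimum 1 for both benchmarks.\<close>

definition competitive_ratio ::
  "('d, 's) two_stage_alg \<Rightarrow> (('d, 's) two_stage \<Rightarrow> real) \<Rightarrow> real" where
  "competitive_ratio ALG OPT =
     (INF I\<in>{I. valid_two_stage I \<and> OPT I > 0}. alg_value ALG I / OPT I)"

definition nbrs_demand :: "('d, 's) two_stage \<Rightarrow> 'd \<Rightarrow> 's set" where
  "nbrs_demand I i = {j \<in> supplies I. (i, j) \<in> edges I}"

definition nbrs_supply :: "('d, 's) two_stage \<Rightarrow> 's \<Rightarrow> 'd set" where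
  "nbrs_supply I j = {i \<in> demand1 I. (i, j) \<in> edges I}"

definition wbu_feasible :: "('d, 's) two_stage \<Rightarrow> ('d \<Rightarrow> 's \<Rightarrow> real) \<Rightarrow> bool" where
  "wbu_feasible I x \<longleftrightarrow>
     (\<forall>i\<in>demand1 I. (\<Sum>j\<in>nbrs_demand I i. x i j) \<le> 1) \<and>
     (\<forall>j\<in>supplies I. (\<Sum>i\<in>nbrs_supply I j. x i j) \<le> 1) \<and>
     (\<forall>(i, j)\<in>edges I. i \<in> demand1 I \<longrightarrow> x i j \<ge> 0)"

definition wbu_objective ::
  "(real \<Rightarrow> real) \<Rightarrow> ('d, 's) two_stage \<Rightarrow> ('d \<Rightarrow> 's \<Rightarrow> real) \<Rightarrow> real" where
  "wbu_objective g I x =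
     (\<Sum>j\<in>supplies I. 1 / weight I j * g (weight I j * (1 - (\<Sum>i\<in>nbrs_supply I j. x i j))))"

text \<open>The optimal solution of the convex program, the distribution with the given marginals and
  the maximum-weight matching of the second stage need not be unique, so this is a predicate that
  holds for every algorithm resulting from some choice of these.\<close>

definition weighted_balanced_utilization ::
  "(real \<Rightarrow> real) \<Rightarrow> ('d, 's) two_stage_alg \<Rightarrow> bool" where
  "weighted_balanced_utilization g ALG \<longleftrightarrow>
     (\<forall>I. valid_two_stage I \<longrightarrow>
        (\<exists>x. is_arg_min (wbu_objective g I) (wbu_feasible I) x \<and>
             set_pmf (first_stage ALG I) \<subseteq> matchings I (demand1 I) (supplies I) \<and>
             (\<forall>(i, j)\<in>edges I. i \<in> demand1 I \<longrightarrow>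
                measure_pmf.prob (first_stage ALG I) {M1. (i, j) \<in> M1} = x i j)) \<and>
        (\<forall>M1\<in>set_pmf (first_stage ALG I). \<forall>A\<in>set_pmf (available_pmf I).
           \<forall>M2\<in>set_pmf (second_stage ALG I M1 A).
             M2 \<in> matchings I A (supplies I - snd ` M1) \<and>
             supply_weight I M2 = mwm I A (supplies I - snd ` M1)))"

end

theory Submission
  imports Defs
begin

text \<open>Let \<open>y\<^sub>j\<close> be the probability that the first stage matches \<open>j\<close>, and
  \<open>u\<^sub>j = w\<^sub>j (1 - y\<^sub>j)\<close> its slack. Shifting mass between two neighbours of \<open>i \<in> D\<^sub>1\<close> shows, by
  strict convexity, that the optimal \<open>x\<close> puts the mass of \<open>i\<close> on neighbours of maximal slack, and
  that this mass is 1 unless this slack is 0. Hence \<open>\<Sum>\<^sub>j u\<^sub>j y\<^sub>j\<close> is at least the total slack of any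
  set \<open>T\<^sub>1\<close> of supply vertices matchable into \<open>D\<^sub>1\<close>. Fix the available set, and let the offline
  optimum match \<open>T\<^sub>1\<close> in the first stage and \<open>T\<^sub>2\<close> in the second. The algorithm can keep those
  second-stage edges whose supply vertex is still free, so it gets at least
  \<open>\<Sum>\<^sub>j w\<^sub>j y\<^sub>j + \<Sum>\<^bsub>j \<in> T\<^sub>2\<^esub> u\<^sub>j\<close>, however the first stage is correlated. Since \<open>y (1 - y) \<le> 1/4\<close>, this
  is at least \<open>3/4 (w(T\<^sub>1) + w(T\<^sub>2))\<close>.\<close>

section \<open>Slopes of strictly convex functions\<close>

lemma strictly_convex_slopes:
  assumes "strictly_convex g" and "x < y" and "y < z"
  shows "(g y - g x) / (y - x) < (g z - g y) / (z - y)"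
proof -
  define t where "t = (y - x) / (z - x)"
  have zt: "(z - x) * t = y - x" using assms by (simp add: t_def)
  then have "(1 - t) * x + t * z = y" by algebra
  moreover have "0 < t" "t < 1" using assms by (auto simp: t_def)
  ultimately have t: "0 < t" "t < 1" "(1 - t) * x + t * z = y" by auto
  have "g y < (1 - t) * g x + t * g z"
    using assms t unfolding strictly_convex_def by (metis less_trans order_less_irrefl)
  then have "(z - x) * g y < (z - x) * ((1 - t) * g x + t * g z)"
    using assms by (intro mult_strict_left_mono) auto
  also have "\<dots> = (z - y) * g x + (y - x) * g z" using zt by algebra
  finally show ?thesis using assms by (simp add: field_simps)
qed

text \<open>Chains the three-point inequality through the interval between \<open>p\<close> and
  \<open>q\<close>. It is meant for two slacks that move towards each other without
  crossing.\<close>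

lemma strictly_convex_slopes_disjoint:
  assumes "strictly_convex g" and "a < p" and "p \<le> q" and "q < b"
  shows "(g p - g a) / (p - a) < (g b - g q) / (b - q)"
proof (cases "p = q")
  case True
  then show ?thesis using strictly_convex_slopes[of g a p b] assms by simp
next
  case False
  then show ?thesis
    using strictly_convex_slopes[of g a p q] strictly_convex_slopes[of g p q b] assms by simp
qed

text \<open>The slope over \<open>[a - 1, a]\<close> is nonnegative by monotonicity, and strict
  convexity makes the slope over \<open>[a, b]\<close> larger still.\<close>

lemma mono_strictly_convex_less:
  fixes g :: "real \<Rightarrow> real"
  assumes "mono g" and "strictly_convex g" and "a < b"
  shows "g a < g b"
proof -
  have "(g a - g (a - 1)) / (a - (a - 1)) < (g b - g a) / (b - a)"
    using strictly_convex_slopes[of g "a - 1" a b] assms by simp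
  moreover have "g (a - 1) \<le> g a" using assms(1) by (simp add: monoD)
  ultimately have "0 < (g b - g a) / (b - a)" by simp
  then show ?thesis using assms(3) by (simp add: zero_less_divide_iff)
qed

section \<open>Perturbing a fractional first-stage matching\<close>

definition load :: "('d, 's) two_stage \<Rightarrow> ('d \<Rightarrow> 's \<Rightarrow> real) \<Rightarrow> 's \<Rightarrow> real" where
  "load I x j = (\<Sum>i\<in>nbrs_supply I j. x i j)"

text \<open>The argument at which the objective evaluates \<open>g\<close>; \<open>load\<close> and
  \<open>slack\<close> are the y and u of the overview.\<close>

definition slack :: "('d, 's) two_stage \<Rightarrow> ('d \<Rightarrow> 's \<Rightarrow> real) \<Rightarrow> 's \<Rightarrow> real" where
  "slack I x j = weight I j * (1 - load I x j)"

text \<open>The change \<open>e\<close> is signed, so a transfer of mass between two edges is a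
  composition of two bumps.\<close>

definition bump :: "('d \<Rightarrow> 's \<Rightarrow> real) \<Rightarrow> 'd \<Rightarrow> 's \<Rightarrow> real \<Rightarrow> 'd \<Rightarrow> 's \<Rightarrow> real" where
  "bump x i j e = (\<lambda>i' j'. x i' j' + (if i' = i \<and> j' = j then e else 0))"

lemma valid_two_stage_finite:
  assumes "valid_two_stage I"
  shows "finite (demand1 I)" "finite (demand2 I)" "finite (supplies I)" "finite (edges I)"
    "finite (nbrs_demand I i)" "finite (nbrs_supply I j)" "finite (matchings I X Y)"
proof -
  show fin: "finite (demand1 I)" "finite (demand2 I)" "finite (supplies I)"
    using assms by (auto simp: valid_two_stage_def)
  have "edges I \<subseteq> (demand1 I \<union> demand2 I) \<times> supplies I"
    using assms by (simp add: valid_two_stage_def)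
  then show e: "finite (edges I)" using fin finite_subset by blast
  show "finite (nbrs_demand I i)" "finite (nbrs_supply I j)"
    using fin by (auto simp: nbrs_demand_def nbrs_supply_def)
  show "finite (matchings I X Y)"
    by (rule finite_subset[of _ "Pow (edges I)"]) (auto simp: matchings_def e)
qed

lemma matching_finite:
  assumes "valid_two_stage I" and "M \<in> matchings I X Y"
  shows "finite M"
  using assms valid_two_stage_finite(4)[OF assms(1)] finite_subset
  by (auto simp: matchings_def)

lemma matching_subset:
  assumes "M \<in> matchings I X Y"
  shows "fst ` M \<subseteq> X" and "snd ` M \<subseteq> Y"
  using assms by (auto simp: matchings_def)

lemma load_bump:
  assumes "valid_two_stage I" and "(i, j) \<in> edges I" and "i \<in> demand1 I"
  shows "load I (bump x i j e) j' = load I x j' + (if j' = j then e else 0)"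
proof -
  have "(\<Sum>i'\<in>nbrs_supply I j'. if i' = i \<and> j' = j then e else 0) = (if j' = j then e else 0)"
    using assms valid_two_stage_finite(6)[OF assms(1)]
    by (cases "j' = j") (simp_all add: nbrs_supply_def)
  then show ?thesis by (simp add: load_def bump_def sum.distrib)
qed

lemma demand_sum_bump:
  assumes "valid_two_stage I" and "(i, j) \<in> edges I" and "i \<in> demand1 I"
  shows "(\<Sum>j'\<in>nbrs_demand I i'. bump x i j e i' j') =
    (\<Sum>j'\<in>nbrs_demand I i'. x i' j') + (if i' = i then e else 0)"
proof -
  have "j \<in> supplies I" using assms by (auto simp: valid_two_stage_def)
  then have "(\<Sum>j'\<in>nbrs_demand I i'. if i' = i \<and> j' = j then e else 0) = (if i' = i then e else 0)"
    using assms valid_two_stage_finite(5)[OF assms(1)]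
    by (cases "i' = i") (simp_all add: nbrs_demand_def)
  then show ?thesis by (simp add: bump_def sum.distrib)
qed

lemma wbu_feasible_load:
  "wbu_feasible I x \<longleftrightarrow>
     (\<forall>i\<in>demand1 I. (\<Sum>j\<in>nbrs_demand I i. x i j) \<le> 1) \<and> (\<forall>j\<in>supplies I. load I x j \<le> 1) \<and>
     (\<forall>i j. (i, j) \<in> edges I \<longrightarrow> i \<in> demand1 I \<longrightarrow> 0 \<le> x i j)"
  by (auto simp: wbu_feasible_def load_def)

text \<open>Only the summand of \<open>j\<close> changes. Thanks to the factor
  \<open>1 / weight I j\<close>, the change per unit of mass is, up to sign, a difference quotient
  of \<open>g\<close>, which makes supply vertices of different weights comparable.\<close>

lemma wbu_objective_bump:
  assumes "valid_two_stage I" and "(i, j) \<in> edges I" and "i \<in> demand1 I"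
  shows "wbu_objective g I (bump x i j e) = wbu_objective g I x
    + (g (slack I x j - weight I j * e) - g (slack I x j)) / weight I j"
proof -
  have j: "j \<in> supplies I" using assms by (auto simp: valid_two_stage_def)
  note fin = valid_two_stage_finite(3)[OF assms(1)]
  have obj: "wbu_objective g I z = (\<Sum>j\<in>supplies I. g (slack I z j) / weight I j)" for z
    by (simp add: wbu_objective_def slack_def load_def)
  have sl: "slack I (bump x i j e) j' = slack I x j' - (if j' = j then weight I j * e else 0)" for j'
    by (simp add: slack_def load_bump[OF assms] algebra_simps)
  show ?thesis
    unfolding obj sl sum.remove[OF fin j] by (simp add: diff_divide_distrib)
qed

section \<open>Optimality conditions of the convex program\<close>

text \<open>If \<open>i\<close> had mass left while \<open>j\<close> has room, adding a little mass
  on \<open>(i, j)\<close> would stay feasible and strictly lower the objective.\<close>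

lemma wbu_optimal_saturated:
  assumes I: "valid_two_stage I" and e: "(i, j) \<in> edges I" "i \<in> demand1 I"
    and g: "mono g" "strictly_convex g"
    and opt: "is_arg_min (wbu_objective g I) (wbu_feasible I) x"
    and pos: "0 < slack I x j"
  shows "(\<Sum>j'\<in>nbrs_demand I i. x i j') = 1"
proof (rule ccontr)
  assume neq: "\<not> ?thesis"
  have feas: "wbu_feasible I x" using opt by (simp add: is_arg_min_def)
  have w: "weight I j > 0" using I e by (auto simp: valid_two_stage_def)
  have "load I x j < 1" using pos w by (simp add: slack_def zero_less_mult_iff)
  moreover have "(\<Sum>j'\<in>nbrs_demand I i. x i j') < 1"
    using feas e neq by (force simp: wbu_feasible_load)
  ultimately obtain d where d: "0 < d" "d \<le> 1 - load I x j" "d \<le> 1 - (\<Sum>j'\<in>nbrs_demand I i. x i j')"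
    by (metis diff_gt_0_iff_gt min.cobounded1 min.cobounded2 min_less_iff_conj)
  have "wbu_feasible I (bump x i j d)"
    using feas d unfolding wbu_feasible_load load_bump[OF I e] demand_sum_bump[OF I e]
    by (auto simp: bump_def add_nonneg_nonneg)
  moreover have "wbu_objective g I (bump x i j d) < wbu_objective g I x"
    using mono_strictly_convex_less[OF g, of "slack I x j - weight I j * d" "slack I x j"] d w
    by (simp add: wbu_objective_bump[OF I e] divide_less_0_iff)
  ultimately show False using opt by (auto simp: is_arg_min_def)
qed

text \<open>An exchange argument: if \<open>k\<close> had the smaller slack, moving mass of
  \<open>i\<close> from \<open>k\<close> to \<open>j\<close> would bring the two slacks closer
  together, which strict convexity rewards.\<close>

lemma wbu_optimal_slack_le:
  assumes I: "valid_two_stage I" and e: "(i, j) \<in> edges I" "(i, k) \<in> edges I" "i \<in> demand1 I"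
    and g: "strictly_convex g"
    and opt: "is_arg_min (wbu_objective g I) (wbu_feasible I) x"
    and pos: "0 < slack I x j" and xk: "0 < x i k"
  shows "slack I x j \<le> slack I x k"
proof (rule ccontr)
  assume "\<not> ?thesis"
  then have lt: "slack I x k < slack I x j" by simp
  then have jk: "j \<noteq> k" by auto
  have feas: "wbu_feasible I x" using opt by (simp add: is_arg_min_def)
  have w: "weight I j > 0" "weight I k > 0" using I e by (auto simp: valid_two_stage_def)
  have "load I x j < 1" using pos w by (simp add: slack_def zero_less_mult_iff)
  \<comment> \<open>The three bounds keep the load of \<open>j\<close> at most 1, keep the mass on
    \<open>(i, k)\<close> nonnegative, and stop the two slacks from crossing
    (\<open>gap\<close>).\<close>
  define d where
    "d = Min {1 - load I x j, x i k, (slack I x j - slack I x k) / (weight I j + weight I k)}"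
  have d: "0 < d" "d \<le> 1 - load I x j" "d \<le> x i k"
    and d': "d \<le> (slack I x j - slack I x k) / (weight I j + weight I k)"
    using \<open>load I x j < 1\<close> xk lt w by (auto simp: d_def)
  have gap: "slack I x k + weight I k * d \<le> slack I x j - weight I j * d"
    using d' w by (simp add: field_simps)
  let ?z = "bump (bump x i k (- d)) i j d"
  \<comment> \<open>The two bumps cancel in the total mass of \<open>i\<close>, and the load of
    \<open>k\<close> only decreases.\<close>
  have "wbu_feasible I ?z"
    using feas d jk
    unfolding wbu_feasible_load load_bump[OF I e(1,3)] demand_sum_bump[OF I e(1,3)]
      load_bump[OF I e(2,3)] demand_sum_bump[OF I e(2,3)]
    by (auto simp: bump_def add_nonneg_nonneg intro: order_trans[of "load I x k - d" "load I x k"])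
  moreover have "wbu_objective g I ?z < wbu_objective g I x"
  proof -
    have "slack I (bump x i k (- d)) j = slack I x j"
      using jk by (simp add: slack_def load_bump[OF I e(2,3)])
    \<comment> \<open>The slack of \<open>k\<close> rises and that of \<open>j\<close> falls over
      intervals that \<open>gap\<close> keeps from overlapping, with the interval of
      \<open>k\<close> below. Cancelling the common factor \<open>d\<close> then gives the two
      changes of the objective.\<close>
    moreover have "(g (slack I x k + weight I k * d) - g (slack I x k)) / (weight I k * d)
      < (g (slack I x j) - g (slack I x j - weight I j * d)) / (weight I j * d)"
      using strictly_convex_slopes_disjoint[OF g _ gap, of "slack I x k" "slack I x j"] d w by simp
    then have "(g (slack I x k + weight I k * d) - g (slack I x k)) / weight I k
      < (g (slack I x j) - g (slack I x j - weight I j * d)) / weight I j"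
      using d w by (simp flip: divide_divide_eq_left add: divide_less_cancel)
    ultimately show ?thesis
      by (simp add: wbu_objective_bump[OF I e(1,3)] wbu_objective_bump[OF I e(2,3)] diff_divide_distrib)
  qed
  ultimately show False using opt by (auto simp: is_arg_min_def)
qed

text \<open>At the optimum every first-stage demand vertex spreads its unit of mass over neighbours of
  maximal slack only.\<close>

lemma wbu_optimal_slack_le_average:
  assumes I: "valid_two_stage I" and e: "(i, j) \<in> edges I" "i \<in> demand1 I"
    and g: "mono g" "strictly_convex g"
    and opt: "is_arg_min (wbu_objective g I) (wbu_feasible I) x"
  shows "slack I x j \<le> (\<Sum>k\<in>nbrs_demand I i. slack I x k * x i k)"
proof -
  have feas: "wbu_feasible I x" using opt by (simp add: is_arg_min_def)
  have w: "weight I k > 0" if "k \<in> supplies I" for k using I that by (auto simp: valid_two_stage_def)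
  have x0: "0 \<le> x i k" if "k \<in> nbrs_demand I i" for k
    using feas that e by (auto simp: wbu_feasible_load nbrs_demand_def)
  have s0: "0 \<le> slack I x k" if "k \<in> nbrs_demand I i" for k
    using feas that w[of k] by (auto simp: wbu_feasible_load nbrs_demand_def slack_def)
  show ?thesis
  proof (cases "0 < slack I x j")
    \<comment> \<open>Both optimality conditions require positive slack at \<open>j\<close>;
      otherwise nonnegativity of the right-hand side is enough.\<close>
    case False
    have "0 \<le> (\<Sum>k\<in>nbrs_demand I i. slack I x k * x i k)"
      using x0 s0 by (intro sum_nonneg) auto
    then show ?thesis using False by linarith
  next
    case True
    have "slack I x j = (\<Sum>k\<in>nbrs_demand I i. slack I x j * x i k)"
      using wbu_optimal_saturated[OF I e g opt True] by (simp flip: sum_distrib_left)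
    also have "\<dots> \<le> (\<Sum>k\<in>nbrs_demand I i. slack I x k * x i k)"
    proof (rule sum_mono)
      fix k assume k: "k \<in> nbrs_demand I i"
      show "slack I x j * x i k \<le> slack I x k * x i k"
      proof (cases "x i k = 0")
        case False
        then have "0 < x i k" using x0[OF k] by simp
        then show ?thesis
          using wbu_optimal_slack_le[OF I e(1) _ e(2) g(2) opt True, of k] k
          by (simp add: nbrs_demand_def)
      qed simp
    qed
    finally show ?thesis .
  qed
qed

lemma sum_snd_matching:
  assumes "M \<in> matchings I X Y"
  shows "(\<Sum>j\<in>snd ` M. f j) = (\<Sum>(i, j)\<in>M. f j)"
proof -
  have "inj_on snd M" using assms by (auto simp: matchings_def inj_on_def)
  then show ?thesis by (simp add: sum.reindex case_prod_beta)
qed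

text \<open>The slack of each matched \<open>j\<close> is charged to its demand partner. Partners
  are distinct, so the averages add up to at most the sum over all of \<open>demand1 I\<close>,
  which regroups by supply vertex.\<close>

lemma wbu_optimal_matching_slack:
  assumes I: "valid_two_stage I" and M: "M \<in> matchings I (demand1 I) (supplies I)"
    and g: "mono g" "strictly_convex g"
    and opt: "is_arg_min (wbu_objective g I) (wbu_feasible I) x"
  shows "(\<Sum>j\<in>snd ` M. slack I x j) \<le> (\<Sum>j\<in>supplies I. slack I x j * load I x j)"
proof -
  have feas: "wbu_feasible I x" using opt by (simp add: is_arg_min_def)
  have M': "M \<subseteq> edges I" "M \<subseteq> demand1 I \<times> supplies I" "inj_on fst M"
    using M by (auto simp: matchings_def inj_on_def)
  have s0: "0 \<le> slack I x k * x i k" if "k \<in> nbrs_demand I i" "i \<in> demand1 I" for i k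
    using feas that I
    by (auto simp: wbu_feasible_load nbrs_demand_def slack_def valid_two_stage_def less_imp_le)
  have "(\<Sum>j\<in>snd ` M. slack I x j) = (\<Sum>(i, j)\<in>M. slack I x j)"
    by (rule sum_snd_matching[OF M])
  also have "\<dots> \<le> (\<Sum>(i, j)\<in>M. \<Sum>k\<in>nbrs_demand I i. slack I x k * x i k)"
    using M' by (intro sum_mono) (auto intro!: wbu_optimal_slack_le_average[OF I _ _ g opt])
  also have "\<dots> = (\<Sum>i\<in>fst ` M. \<Sum>k\<in>nbrs_demand I i. slack I x k * x i k)"
    using M'(3) by (simp add: sum.reindex case_prod_beta)
  also have "\<dots> \<le> (\<Sum>i\<in>demand1 I. \<Sum>k\<in>nbrs_demand I i. slack I x k * x i k)"
    using M' valid_two_stage_finite[OF I] s0 by (intro sum_mono2 sum_nonneg) auto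
  also have "\<dots> = (\<Sum>k\<in>supplies I. \<Sum>i\<in>nbrs_supply I k. slack I x k * x i k)"
    unfolding nbrs_demand_def nbrs_supply_def
    by (rule sum.swap_restrict) (use valid_two_stage_finite[OF I] in auto)
  also have "\<dots> = (\<Sum>k\<in>supplies I. slack I x k * load I x k)"
    by (simp add: load_def sum_distrib_left)
  finally show ?thesis .
qed

text \<open>Writing \<open>y\<close> for the load, the slack inequality leaves a weighted sum of
  \<open>y\<^sup>2 - y + 1/4 = (y - 1/2)\<^sup>2\<close>.\<close>

lemma three_quarters_bound:
  fixes w y :: "'s \<Rightarrow> real"
  assumes "finite S" and "T1 \<subseteq> S" and "T2 \<subseteq> S" and "T1 \<inter> T2 = {}"
    and w: "\<And>j. j \<in> S \<Longrightarrow> 0 \<le> w j"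
    and slack: "(\<Sum>j\<in>T1. w j * (1 - y j)) \<le> (\<Sum>j\<in>S. w j * (1 - y j) * y j)"
  shows "3 / 4 * (sum w T1 + sum w T2) \<le> (\<Sum>j\<in>S. w j * y j) + (\<Sum>j\<in>T2. w j * (1 - y j))"
proof -
  have ind: "sum f T = (\<Sum>j\<in>S. if j \<in> T then f j else 0)" if "T \<subseteq> S" for T and f :: "'s \<Rightarrow> real"
    using that assms(1) by (simp add: sum.inter_restrict[symmetric] inf_absorb2)
  \<comment> \<open>The nonnegative gap of the slack inequality is added to the left side, so that
    the claim can be checked vertex by vertex.\<close>
  have "(\<Sum>j\<in>S. 3 / 4 * ((if j \<in> T1 then w j else 0) + (if j \<in> T2 then w j else 0))
      + (w j * (1 - y j) * y j - (if j \<in> T1 then w j * (1 - y j) else 0)))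
    \<le> (\<Sum>j\<in>S. w j * y j + (if j \<in> T2 then w j * (1 - y j) else 0))"
  proof (rule sum_mono)
    fix j assume "j \<in> S"
    \<comment> \<open>The first square settles \<open>j\<close> in \<open>T1\<close> or in
      \<open>T2\<close>, the second settles \<open>j\<close> in neither.\<close>
    then have "0 \<le> w j * (y j - 1 / 2)\<^sup>2" "0 \<le> w j * (y j)\<^sup>2" using w by auto
    then show "3 / 4 * ((if j \<in> T1 then w j else 0) + (if j \<in> T2 then w j else 0))
      + (w j * (1 - y j) * y j - (if j \<in> T1 then w j * (1 - y j) else 0))
      \<le> w j * y j + (if j \<in> T2 then w j * (1 - y j) else 0)"
      using assms(4) by (auto simp: power2_eq_square algebra_simps)
  qed
  then show ?thesis
    using slack by (simp only: sum.distrib sum_subtractf ind[OF assms(2)] ind[OF assms(3)]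
        flip: sum_distrib_left)
qed

section \<open>Maximum-weight matchings and the bound for a fixed available set\<close>

lemma mwm_ge:
  assumes "valid_two_stage I" and "M \<in> matchings I X Y"
  shows "supply_weight I M \<le> mwm I X Y"
  using assms valid_two_stage_finite(7)[OF assms(1)] by (simp add: mwm_def)

lemma mwm_attained:
  assumes "valid_two_stage I"
  obtains M where "M \<in> matchings I X Y" and "mwm I X Y = supply_weight I M"
proof -
  have "{} \<in> matchings I X Y" by (simp add: matchings_def)
  then have "mwm I X Y \<in> supply_weight I ` matchings I X Y"
    unfolding mwm_def using valid_two_stage_finite(7)[OF assms] by (intro Max_in) auto
  then show thesis using that by auto
qed

lemma mwm_nonneg:
  assumes "valid_two_stage I"
  shows "0 \<le> mwm I X Y"
  using mwm_ge[OF assms, of "{}" X Y] by (simp add: matchings_def supply_weight_def)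

lemma set_available_pmf:
  assumes "valid_two_stage I"
  shows "A \<in> set_pmf (available_pmf I) \<Longrightarrow> A \<subseteq> demand2 I" "finite (set_pmf (available_pmf I))"
proof -
  show *: "A \<in> set_pmf (available_pmf I) \<Longrightarrow> A \<subseteq> demand2 I" for A
    by (auto simp: available_pmf_def)
  show "finite (set_pmf (available_pmf I))"
    by (rule finite_subset[of _ "Pow (demand2 I)"]) (auto dest: * simp: valid_two_stage_finite[OF assms])
qed

text \<open>The edges of \<open>M\<close> whose supply vertex avoids \<open>T\<close> remain usable.
  The left side is affine in the indicator of \<open>T\<close>, so its expectation will depend only
  on marginals.\<close>

lemma second_stage_bound:
  assumes I: "valid_two_stage I" and M: "M \<in> matchings I A (supplies I)"
  shows "(\<Sum>j\<in>snd ` M. weight I j * (1 - indicator T j)) \<le> mwm I A (supplies I - T)"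
proof -
  let ?M = "{e \<in> M. snd e \<notin> T}"
  have "?M \<in> matchings I A (supplies I - T)" using M by (auto simp: matchings_def)
  then have "supply_weight I ?M \<le> mwm I A (supplies I - T)" by (rule mwm_ge[OF I])
  moreover have "snd ` ?M = {j \<in> snd ` M. j \<notin> T}" by auto
  then have "supply_weight I ?M = (\<Sum>j\<in>snd ` M. if j \<notin> T then weight I j else 0)"
    unfolding supply_weight_def using matching_finite[OF I M] by (simp add: sum.inter_filter)
  moreover have "\<dots> = (\<Sum>j\<in>snd ` M. weight I j * (1 - indicator T j))"
    by (intro sum.cong) auto
  ultimately show ?thesis by simp
qed

text \<open>A matching has at most one edge at \<open>j\<close>, so the indicator that
  \<open>j\<close> is matched is the sum of the indicators of its edges; linearity of expectation
  does the rest.\<close>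

lemma expectation_matched_eq_load:
  assumes I: "valid_two_stage I"
    and supp: "set_pmf p \<subseteq> matchings I (demand1 I) (supplies I)"
    and marg: "\<And>i j. (i, j) \<in> edges I \<Longrightarrow> i \<in> demand1 I \<Longrightarrow>
      measure_pmf.prob p {M. (i, j) \<in> M} = x i j"
  shows "measure_pmf.expectation p (\<lambda>M. indicator (snd ` M) j) = load I x j"
proof -
  have "measure_pmf.expectation p (\<lambda>M. indicator (snd ` M) j :: real) =
    measure_pmf.expectation p (\<lambda>M. \<Sum>i\<in>nbrs_supply I j. indicator {M. (i, j) \<in> M} M)"
  proof (rule integral_cong_AE)
    have "indicator (snd ` M) j = (\<Sum>i\<in>nbrs_supply I j. indicator {M. (i, j) \<in> M} M :: real)"
      if "M \<in> set_pmf p" for M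
    proof -
      have M: "M \<in> matchings I (demand1 I) (supplies I)" using that supp by auto
      show ?thesis
      proof (cases "j \<in> snd ` M")
        case True
        then obtain i where i: "(i, j) \<in> M" by auto
        then have "i \<in> nbrs_supply I j" using M by (auto simp: nbrs_supply_def matchings_def)
        moreover have "indicator {M. (i', j) \<in> M} M = (if i' = i then 1 else 0 :: real)" for i'
          using i M by (fastforce simp: matchings_def indicator_def)
        ultimately show ?thesis using True valid_two_stage_finite(6)[OF I] by simp
      next
        case False
        then have "(i, j) \<notin> M" for i by force
        then show ?thesis using False by simp
      qed
    qed
    then show "AE M in measure_pmf p. indicator (snd ` M) j =
      (\<Sum>i\<in>nbrs_supply I j. indicator {M. (i, j) \<in> M} M :: real)"
      by (simp add: AE_measure_pmf_iff)
  qed auto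
  also have "\<dots> = (\<Sum>i\<in>nbrs_supply I j. measure_pmf.prob p {M. (i, j) \<in> M})"
    by (subst Bochner_Integration.integral_sum)
      (auto intro!: integrable_measure_pmf_finite finite_subset[OF supp] valid_two_stage_finite(7)[OF I])
  also have "\<dots> = load I x j"
    unfolding load_def using marg by (intro sum.cong) (auto simp: nbrs_supply_def)
  finally show ?thesis .
qed

text \<open>The offline optimum for the fixed set \<open>A\<close> is split by demand side, and its
  two parts supply the sets T1 and T2 of the overview.\<close>

lemma wbu_expectation_bound:
  assumes I: "valid_two_stage I" and g: "mono g" "strictly_convex g"
    and opt: "is_arg_min (wbu_objective g I) (wbu_feasible I) x"
    and supp: "set_pmf p \<subseteq> matchings I (demand1 I) (supplies I)"
    and marg: "\<And>i j. (i, j) \<in> edges I \<Longrightarrow> i \<in> demand1 I \<Longrightarrow>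
      measure_pmf.prob p {M. (i, j) \<in> M} = x i j"
    and A: "A \<subseteq> demand2 I"
  shows "3 / 4 * mwm I (demand1 I \<union> A) (supplies I) \<le>
    measure_pmf.expectation p (\<lambda>M. supply_weight I M + mwm I A (supplies I - snd ` M))"
proof -
  let ?S = "supplies I" and ?w = "weight I" and ?y = "load I x"
  obtain N where N: "N \<in> matchings I (demand1 I \<union> A) ?S"
    and opt_N: "mwm I (demand1 I \<union> A) ?S = supply_weight I N"
    by (rule mwm_attained[OF I])
  define N1 N2 where "N1 = {e \<in> N. fst e \<in> demand1 I}" and "N2 = {e \<in> N. fst e \<notin> demand1 I}"
  have N1: "N1 \<in> matchings I (demand1 I) ?S" and N2: "N2 \<in> matchings I A ?S"
    using N by (auto simp: N1_def N2_def matchings_def)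
  have N12: "snd ` N1 \<inter> snd ` N2 = {}"
    using N unfolding N1_def N2_def matchings_def by fastforce
  have sub: "snd ` N1 \<subseteq> ?S" "snd ` N2 \<subseteq> ?S" using N1 N2 by (auto simp: matchings_def)
  have "N = N1 \<union> N2" by (auto simp: N1_def N2_def)
  then have wN: "supply_weight I N = sum ?w (snd ` N1) + sum ?w (snd ` N2)"
    using N12 matching_finite[OF I N1] matching_finite[OF I N2]
    by (simp add: supply_weight_def image_Un sum.union_disjoint)
  have finp: "finite (set_pmf p)"
    using supp valid_two_stage_finite(7)[OF I] finite_subset by blast
  have int: "integrable (measure_pmf p) f" for f :: "('a \<times> 'b) set \<Rightarrow> real"
    by (rule integrable_measure_pmf_finite[OF finp])
  have w0: "j \<in> ?S \<Longrightarrow> 0 \<le> ?w j" for j using I by (auto simp: valid_two_stage_def less_imp_le)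
  have "3 / 4 * (sum ?w (snd ` N1) + sum ?w (snd ` N2)) \<le>
    (\<Sum>j\<in>?S. ?w j * ?y j) + (\<Sum>j\<in>snd ` N2. ?w j * (1 - ?y j))"
    using wbu_optimal_matching_slack[OF I N1 g opt] w0
    by (intro three_quarters_bound[OF valid_two_stage_finite(3)[OF I] sub N12])
      (auto simp: slack_def)
  \<comment> \<open>Both sums are affine in the indicators of matched vertices, so correlations
    within \<open>p\<close> have no effect.\<close>
  also have "\<dots> = measure_pmf.expectation p (\<lambda>M. (\<Sum>j\<in>?S. ?w j * indicator (snd ` M) j)
      + (\<Sum>j\<in>snd ` N2. ?w j * (1 - indicator (snd ` M) j)))"
    by (simp add: int Bochner_Integration.integral_sum
        expectation_matched_eq_load[OF I supp marg])
  also have "\<dots> \<le> measure_pmf.expectation p (\<lambda>M. supply_weight I M + mwm I A (?S - snd ` M))"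
  proof (rule integral_mono_AE[OF int int], unfold AE_measure_pmf_iff, rule ballI, rule add_mono)
    fix M assume "M \<in> set_pmf p"
    then have "M \<in> matchings I (demand1 I) ?S" using supp by auto
    then have "snd ` M \<subseteq> ?S" by (auto simp: matchings_def)
    then show "(\<Sum>j\<in>?S. ?w j * indicator (snd ` M) j) \<le> supply_weight I M"
      using valid_two_stage_finite(3)[OF I]
      by (simp add: supply_weight_def Collect_conj_eq inf_absorb2)
    show "(\<Sum>j\<in>snd ` N2. ?w j * (1 - indicator (snd ` M) j)) \<le> mwm I A (?S - snd ` M)"
      by (rule second_stage_bound[OF I N2])
  qed
  finally show ?thesis using opt_N wN by simp
qed

section \<open>The value of the algorithm\<close>

text \<open>A uniform bound on \<open>h\<close> yields the tower rule for every kernel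
  \<open>f\<close>. This matters because \<open>second_stage\<close> is arbitrary off the supports
  of the first stage and of the available set.\<close>

lemma expectation_bind_pmf:
  fixes h :: "'b \<Rightarrow> real"
  assumes "\<And>y. norm (h y) \<le> B"
  shows "measure_pmf.expectation (bind_pmf p f) h =
    measure_pmf.expectation p (\<lambda>x. measure_pmf.expectation (f x) h)"
  unfolding measure_pmf_bind
  by (rule integral_bind[where K = "count_space UNIV" and B = B and B' = 1])
    (use assms measurable_measure_pmf[of f] in \<open>auto simp: measure_pmf.emeasure_space_1\<close>)

text \<open>The two stages match disjoint sets of supply vertices, so their weights add. The
  expectation over the available set is outermost so that the bound for fixed \<open>A\<close>
  applies inside it.\<close>

lemma alg_value_eq:
  fixes ALG :: "('a, 'b) two_stage_alg"
  assumes I: "valid_two_stage I" and wbu: "weighted_balanced_utilization g ALG"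
  shows "alg_value ALG I = measure_pmf.expectation (available_pmf I) (\<lambda>A.
    measure_pmf.expectation (first_stage ALG I)
      (\<lambda>M. supply_weight I M + mwm I A (supplies I - snd ` M)))"
proof -
  let ?S = "supplies I" and ?w = "weight I"
  define h :: "('a \<times> 'b) set \<Rightarrow> real" where "h = (\<lambda>M. \<Sum>j\<in>?S. ?w j * indicator (snd ` M) j)"
  have bnd: "norm (h M) \<le> sum ?w ?S" for M :: "('a \<times> 'b) set"
  proof -
    have "\<bar>h M\<bar> \<le> (\<Sum>j\<in>?S. \<bar>?w j * indicator (snd ` M) j\<bar>)" unfolding h_def by (rule sum_abs)
    also have "\<dots> \<le> sum ?w ?S"
      using I by (intro sum_mono) (auto simp: indicator_def valid_two_stage_def)
    finally show ?thesis by simp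
  qed
  have supp: "set_pmf (first_stage ALG I) \<subseteq> matchings I (demand1 I) ?S"
    using I wbu unfolding weighted_balanced_utilization_def by blast
  have value_h: "h (M1 \<union> M2) = supply_weight I M1 + mwm I A (?S - snd ` M1)"
    if "M1 \<in> set_pmf (first_stage ALG I)" "A \<in> set_pmf (available_pmf I)"
      "M2 \<in> set_pmf (second_stage ALG I M1 A)" for M1 M2 A
  proof -
    have M1: "M1 \<in> matchings I (demand1 I) ?S" using supp that by auto
    have M2: "M2 \<in> matchings I A (?S - snd ` M1)"
      "supply_weight I M2 = mwm I A (?S - snd ` M1)"
      using I wbu that unfolding weighted_balanced_utilization_def by blast+
    have "snd ` M1 \<subseteq> ?S" "snd ` M2 \<subseteq> ?S - snd ` M1"
      using matching_subset[OF M1] matching_subset[OF M2(1)] by auto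
    then have sub: "snd ` (M1 \<union> M2) \<subseteq> ?S" and disj: "snd ` M1 \<inter> snd ` M2 = {}" by blast+
    have "h (M1 \<union> M2) = sum ?w (snd ` (M1 \<union> M2))"
      using sub valid_two_stage_finite(3)[OF I]
      by (simp add: h_def Collect_conj_eq inf_absorb2)
    also have "\<dots> = supply_weight I M1 + supply_weight I M2"
      using disj matching_finite[OF I M1] matching_finite[OF I M2(1)]
      by (simp add: supply_weight_def image_Un sum.union_disjoint)
    finally show ?thesis using M2 by simp
  qed
  \<comment> \<open>The first stage and the available set are drawn independently, so the order of
    the draws can be swapped.\<close>
  have "alg_value ALG I = measure_pmf.expectation
    (bind_pmf (available_pmf I) (\<lambda>A. bind_pmf (first_stage ALG I) (\<lambda>M1.
      map_pmf (\<lambda>M2. M1 \<union> M2) (second_stage ALG I M1 A)))) h"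
    unfolding alg_value_def alg_outcome_def h_def by (subst bind_commute_pmf) (rule refl)
  also have "\<dots> = measure_pmf.expectation (available_pmf I) (\<lambda>A.
      measure_pmf.expectation (first_stage ALG I) (\<lambda>M1.
      measure_pmf.expectation (second_stage ALG I M1 A) (\<lambda>M2. h (M1 \<union> M2))))"
    by (simp add: expectation_bind_pmf[OF bnd])
  also have "\<dots> = measure_pmf.expectation (available_pmf I) (\<lambda>A.
      measure_pmf.expectation (first_stage ALG I)
        (\<lambda>M. supply_weight I M + mwm I A (?S - snd ` M)))"
  proof (intro integral_cong_AE, simp_all add: AE_measure_pmf_iff, intro ballI integral_cong_AE,
      simp_all add: AE_measure_pmf_iff, intro ballI)
    fix A M1 assume AM: "A \<in> set_pmf (available_pmf I)" "M1 \<in> set_pmf (first_stage ALG I)"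
    have "measure_pmf.expectation (second_stage ALG I M1 A) (\<lambda>M2. h (M1 \<union> M2)) =
      measure_pmf.expectation (second_stage ALG I M1 A)
        (\<lambda>M2. supply_weight I M1 + mwm I A (?S - snd ` M1))"
      by (intro integral_cong_AE) (auto simp: AE_measure_pmf_iff value_h[OF AM(2,1)])
    then show "measure_pmf.expectation (second_stage ALG I M1 A) (\<lambda>M2. h (M1 \<union> M2)) =
      supply_weight I M1 + mwm I A (?S - snd ` M1)" by simp
  qed
  finally show ?thesis .
qed

lemma alg_value_ge:
  assumes I: "valid_two_stage I" and g: "mono g" "strictly_convex g"
    and wbu: "weighted_balanced_utilization g ALG"
  shows "3 / 4 * opt_offline I \<le> alg_value ALG I"
proof -
  obtain x where x: "is_arg_min (wbu_objective g I) (wbu_feasible I) x"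
    "set_pmf (first_stage ALG I) \<subseteq> matchings I (demand1 I) (supplies I)"
    "\<forall>(i, j)\<in>edges I. i \<in> demand1 I \<longrightarrow>
       measure_pmf.prob (first_stage ALG I) {M1. (i, j) \<in> M1} = x i j"
    using I wbu unfolding weighted_balanced_utilization_def by blast
  note int = integrable_measure_pmf_finite[OF set_available_pmf(2)[OF I]]
  have "3 / 4 * opt_offline I =
    measure_pmf.expectation (available_pmf I) (\<lambda>A. 3 / 4 * mwm I (demand1 I \<union> A) (supplies I))"
    by (simp add: opt_offline_def)
  also have "\<dots> \<le> alg_value ALG I"
    unfolding alg_value_eq[OF I wbu]
  proof (rule integral_mono_AE[OF int int], unfold AE_measure_pmf_iff, rule ballI)
    fix A assume "A \<in> set_pmf (available_pmf I)"
    then show "3 / 4 * mwm I (demand1 I \<union> A) (supplies I) \<le> measure_pmf.expectation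
        (first_stage ALG I) (\<lambda>M. supply_weight I M + mwm I A (supplies I - snd ` M))"
      using x(3) by (intro wbu_expectation_bound[OF I g x(1,2)] set_available_pmf(1)[OF I]) auto
  qed
  finally show ?thesis .
qed

section \<open>Comparing the benchmarks and their ratios\<close>

text \<open>For each available set, a first-stage matching joined with an optimal second-stage
  matching is a candidate for the offline optimum, since the two share no demand and no supply
  vertex.\<close>

lemma opt_online_le_opt_offline:
  assumes I: "valid_two_stage I"
  shows "opt_online I \<le> opt_offline I"
proof -
  let ?S = "supplies I"
  note int = integrable_measure_pmf_finite[OF set_available_pmf(2)[OF I]]
  have "supply_weight I M +
      measure_pmf.expectation (available_pmf I) (\<lambda>A. mwm I A (?S - snd ` M)) \<le> opt_offline I"
    if M: "M \<in> matchings I (demand1 I) ?S" for M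
  proof -
    have "supply_weight I M + mwm I A (?S - snd ` M) \<le> mwm I (demand1 I \<union> A) ?S"
      if A: "A \<subseteq> demand2 I" for A
    proof -
      obtain N where N: "N \<in> matchings I A (?S - snd ` M)"
        and opt_N: "mwm I A (?S - snd ` M) = supply_weight I N"
        by (rule mwm_attained[OF I])
      have disj: "snd ` M \<inter> snd ` N = {}" "fst ` M \<inter> fst ` N = {}"
        using matching_subset[OF M] matching_subset[OF N] A I
        unfolding valid_two_stage_def by blast+
      then have cross: "fst e \<noteq> fst f" "snd e \<noteq> snd f" if "e \<in> M" "f \<in> N" for e f
        using that by blast+
      have "M \<union> N \<in> matchings I (demand1 I \<union> A) ?S"
        unfolding matchings_def mem_Collect_eq
      proof (intro conjI ballI impI)
        show "M \<union> N \<subseteq> edges I \<inter> (demand1 I \<union> A) \<times> ?S" using M N by (auto simp: matchings_def)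
        fix e f assume "e \<in> M \<union> N" "f \<in> M \<union> N" "fst e = fst f \<or> snd e = snd f"
        then show "e = f"
          using M N cross[of e f] cross[of f e] by (auto simp: matchings_def)
      qed
      then have "supply_weight I (M \<union> N) \<le> mwm I (demand1 I \<union> A) ?S" by (rule mwm_ge[OF I])
      moreover have "supply_weight I (M \<union> N) = supply_weight I M + supply_weight I N"
        using disj matching_finite[OF I M] matching_finite[OF I N]
        by (simp add: supply_weight_def image_Un sum.union_disjoint)
      ultimately show ?thesis using opt_N by simp
    qed
    then have "measure_pmf.expectation (available_pmf I)
        (\<lambda>A. supply_weight I M + mwm I A (?S - snd ` M)) \<le> opt_offline I"
      unfolding opt_offline_def
      by (intro integral_mono_AE[OF int int])
        (auto simp: AE_measure_pmf_iff dest: set_available_pmf(1)[OF I])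
    then show ?thesis by (simp add: int)
  qed
  moreover have "{} \<in> matchings I (demand1 I) ?S" by (simp add: matchings_def)
  ultimately show ?thesis
    unfolding opt_online_def using valid_two_stage_finite(7)[OF I]
    by (subst Max_le_iff) auto
qed

text \<open>Makes the index sets of both infima nonempty, without which a real \<open>INF\<close>
  carries no information. The witness is a single first-stage edge of weight 1.\<close>

lemma ex_opt_online_pos:
  "\<exists>I :: ('d, 's) two_stage. valid_two_stage I \<and> 0 < opt_online I"
proof -
  fix d :: 'd and s :: 's
  let ?I = "\<lparr>demand1 = {d}, demand2 = {}, supplies = {s}, edges = {(d, s)},
    weight = (\<lambda>_. 1), avail_prob = (\<lambda>_. 0)\<rparr> :: ('d, 's) two_stage"
  let ?f = "\<lambda>M. supply_weight ?I M +
    measure_pmf.expectation (available_pmf ?I) (\<lambda>A. mwm ?I A (supplies ?I - snd ` M))"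
  have I: "valid_two_stage ?I" by (simp add: valid_two_stage_def)
  have "{(d, s)} \<in> matchings ?I (demand1 ?I) (supplies ?I)" by (simp add: matchings_def)
  then have "?f {(d, s)} \<le> opt_online ?I"
    unfolding opt_online_def using valid_two_stage_finite(7)[OF I] by (intro Max_ge finite_imageI imageI)
  moreover have "0 \<le> measure_pmf.expectation (available_pmf ?I)
      (\<lambda>A. mwm ?I A (supplies ?I - snd ` {(d, s)}))"
    by (intro Bochner_Integration.integral_nonneg mwm_nonneg[OF I])
  moreover have "supply_weight ?I {(d, s)} = 1" by (simp add: supply_weight_def)
  ultimately have "0 < opt_online ?I" by linarith
  then show ?thesis using I by blast
qed

theorem theorem1:
  fixes g :: "real \<Rightarrow> real" and ALG :: "('d, 's) two_stage_alg"
  assumes "\<And>x. g differentiable (at x)"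
    and "mono g"
    and "strictly_convex g"
    and "weighted_balanced_utilization g ALG"
  shows "competitive_ratio ALG opt_online \<ge> competitive_ratio ALG opt_offline \<and>
         competitive_ratio ALG opt_offline \<ge> 3 / 4"
proof -
  have ratio: "3 / 4 \<le> alg_value ALG I / opt_offline I"
    if "valid_two_stage I" "0 < opt_offline I" for I
    using alg_value_ge[OF that(1) assms(2-4)] that(2) by (simp add: field_simps)
  have pos: "0 < opt_offline I" if "valid_two_stage I" "0 < opt_online I"
    for I :: "('d, 's) two_stage"
    using opt_online_le_opt_offline[OF that(1)] that(2) by simp
  have ne: "{I :: ('d, 's) two_stage. valid_two_stage I \<and> opt_online I > 0} \<noteq> {}"
    using ex_opt_online_pos by blast
  have "competitive_ratio ALG opt_offline \<le> competitive_ratio ALG opt_online"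
    unfolding competitive_ratio_def
  proof (rule cINF_mono[OF ne])
    show "bdd_below ((\<lambda>I. alg_value ALG I / opt_offline I)
        ` {I. valid_two_stage I \<and> 0 < opt_offline I})"
      using ratio by (auto simp: bdd_below_def intro!: exI[of _ "3 / 4"])
    fix I :: "('d, 's) two_stage" assume "I \<in> {I. valid_two_stage I \<and> 0 < opt_online I}"
    then have I: "valid_two_stage I" "0 < opt_online I" by auto
    \<comment> \<open>Enlarging the denominator lowers the ratio only if the numerator is
      nonnegative.\<close>
    have "0 \<le> alg_value ALG I"
      using alg_value_ge[OF I(1) assms(2-4)] pos[OF I] by linarith
    then have "alg_value ALG I / opt_offline I \<le> alg_value ALG I / opt_online I"
      using opt_online_le_opt_offline[OF I(1)] I pos[OF I] by (intro divide_left_mono) auto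
    then show "\<exists>I'\<in>{I. valid_two_stage I \<and> 0 < opt_offline I}.
        alg_value ALG I' / opt_offline I' \<le> alg_value ALG I / opt_online I"
      using I(1) pos[OF I] by blast
  qed
  moreover have "3 / 4 \<le> competitive_ratio ALG opt_offline"
    unfolding competitive_ratio_def
    using ne pos ratio by (intro cINF_greatest) auto
  ultimately show ?thesis by simp
qed

end
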